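(* Let $S$ be a finite set of distinct irreducible hypersurfaces in $\mathbb G_m^n$ (coordinates $\alpha_1,\dots,\alpha_n$), and let $\pi:\mathbb G_m^n\to\mathbb G_m^{n-1}$ be the projection forgetting $\alpha_1$. Suppose that every horizontal component of $S$ is of degree one in the fiber coordinate $\alpha_1$, and let $M\geq 1$ be the number of horizontal components. Then the natural maps $\rho$ and $\overline\rho$ (classifying the marked points cut out on the fibers) give a commutative diagram mapping to the open moduli spaces $$\begin{array}{ccc}\mathbb G_m^n\setminus\big(S\cup\pi^{-1}L(S,\pi)\big)&\xrightarrow{\ \rho\ }&\mathfrak M_{0,M+3}\\ {\scriptstyle\pi}\downarrow&&\downarrow{\scriptstyle f}\\ \mathbb G_m^{n-1}\setminus L(S,\pi)&\xrightarrow{\ \overline\rho\ }&\mathfrak M_{0,M+2}\end{array}$$ where $f$ is the map which forgets one of the marked points.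
   Context: $\mathfrak M_{0,m}$ is the moduli space of smooth genus $0$ curves with $m$ distinct ordered marked points. Hypersurfaces are given by irreducible polynomials with integer coefficients. A component of $S$ is vertical if its defining polynomial has degree $0$ in $\alpha_1$, and horizontal otherwise. Let the horizontal components be the zero loci of $f_i=a_i\alpha_1+b_i$, with $a_i,b_i\in\mathbb Z[\alpha_2,\dots,\alpha_n]$, $a_ib_i\ne0$, $1\le i\le M$. The Landau variety $L(S,\pi)\subset\mathbb G_m^{n-1}$ is the union of (the images of) the vertical components and the zero loci of all $a_i$, $b_i$ ($1\le i\le M$) and $a_ib_j-a_jb_i$ ($1\le i<j\le M$). Natural maps: $\overline\rho$ sends a point $t$ of $\mathbb G_m^{n-1}\setminus L(S,\pi)$ to the class of $\mathbb P^1$ with the $M+2$ marked points $0,\infty$ and $-b_i(t)/a_i(t)$, $1\le i\le M$; $\rho$ sends a point $(\alpha_1,t)$ to the class of $\mathbb P^1$ with these $M+2$ marked points together with the additional marked point $\alpha_1$. *)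

theory Defs
  imports
    Complex_Main
    "HOL-Library.FuncSet"
    "HOL-Library.Poly_Mapping"
    "HOL-Computational_Algebra.Factorial_Ring"
begin

section \<open>Integer polynomials and the torus\<close>

text \<open>
  A polynomial maps exponent vectors to coefficients.  The variables are indexed by all natural
  numbers; the ring of polynomials in the variables \<open>\<alpha>\<^sub>i\<close> with \<open>i \<in> I\<close> is the subring
  \<open>int_polys I\<close>.  This subring is closed under divisors of nonzero elements and contains all units,
  so irreducibility in it and in the ambient ring agree.
\<close>

type_synonym int_mpoly = "(nat \<Rightarrow>\<^sub>0 nat) \<Rightarrow>\<^sub>0 int"

definition int_polys :: "nat set \<Rightarrow> int_mpoly set" where
  "int_polys I = {p. \<forall>m \<in> Poly_Mapping.keys p. Poly_Mapping.keys m \<subseteq> I}"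

definition Var :: "nat \<Rightarrow> int_mpoly" where
  "Var i = Poly_Mapping.single (Poly_Mapping.single i 1) 1"

definition degree_in :: "nat \<Rightarrow> int_mpoly \<Rightarrow> nat" where
  "degree_in i p = Max (insert 0 ((\<lambda>m. Poly_Mapping.lookup m i) ` Poly_Mapping.keys p))"

definition peval :: "int_mpoly \<Rightarrow> (nat \<Rightarrow> complex) \<Rightarrow> complex" where
  "peval p x = (\<Sum>m \<in> Poly_Mapping.keys p.
     of_int (Poly_Mapping.lookup p m) * (\<Prod>i \<in> Poly_Mapping.keys m. x i ^ Poly_Mapping.lookup m i))"

text \<open>
  The torus \<open>\<G>\<^sub>m\<^sup>n\<close> is \<open>torus {1..n}\<close> and \<open>\<G>\<^sub>m\<^sup>n\<^sup>-\<^sup>1\<close>, with the coordinates \<open>\<alpha>\<^sub>2, \<dots>, \<alpha>\<^sub>n\<close>, is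
  \<open>torus {2..n}\<close> (a point if \<open>n = 1\<close>).
\<close>

definition torus :: "nat set \<Rightarrow> (nat \<Rightarrow> complex) set" where
  "torus I = I \<rightarrow>\<^sub>E (UNIV - {0})"

definition zero_locus :: "nat set \<Rightarrow> int_mpoly \<Rightarrow> (nat \<Rightarrow> complex) set" where
  "zero_locus I p = {x \<in> torus I. peval p x = 0}"

definition proj :: "nat \<Rightarrow> (nat \<Rightarrow> complex) \<Rightarrow> (nat \<Rightarrow> complex)" where
  "proj n x = restrict x {2..n}"

text \<open>
  Polynomials with empty zero locus in the torus (the constants and the variables) do not
  define a hypersurface.
\<close>

definition irreducible_hypersurface :: "nat \<Rightarrow> int_mpoly \<Rightarrow> bool" where
  "irreducible_hypersurface n p \<longleftrightarrow>
     p \<in> int_polys {1..n} \<and> irreducible p \<and> zero_locus {1..n} p \<noteq> {}"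

definition vertical :: "int_mpoly set \<Rightarrow> int_mpoly set" where
  "vertical S = {p \<in> S. degree_in 1 p = 0}"

definition horizontal :: "int_mpoly set \<Rightarrow> int_mpoly set" where
  "horizontal S = {p \<in> S. degree_in 1 p \<noteq> 0}"

definition landau_variety ::
    "nat \<Rightarrow> int_mpoly set \<Rightarrow> nat \<Rightarrow> (nat \<Rightarrow> int_mpoly) \<Rightarrow> (nat \<Rightarrow> int_mpoly) \<Rightarrow> (nat \<Rightarrow> complex) set" where
  "landau_variety n S M a b =
     (\<Union>p \<in> vertical S. proj n ` zero_locus {1..n} p)
     \<union> (\<Union>i \<in> {1..M}. zero_locus {2..n} (a i) \<union> zero_locus {2..n} (b i))
     \<union> (\<Union>j \<in> {1..M}. \<Union>i \<in> {1..<j}. zero_locus {2..n} (a i * b j - a j * b i))"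

definition total_complement ::
    "nat \<Rightarrow> int_mpoly set \<Rightarrow> nat \<Rightarrow> (nat \<Rightarrow> int_mpoly) \<Rightarrow> (nat \<Rightarrow> int_mpoly) \<Rightarrow> (nat \<Rightarrow> complex) set" where
  "total_complement n S M a b =
     torus {1..n} - ((\<Union>p \<in> S. zero_locus {1..n} p) \<union> proj n -` landau_variety n S M a b)"

definition base_complement ::
    "nat \<Rightarrow> int_mpoly set \<Rightarrow> nat \<Rightarrow> (nat \<Rightarrow> int_mpoly) \<Rightarrow> (nat \<Rightarrow> int_mpoly) \<Rightarrow> (nat \<Rightarrow> complex) set" where
  "base_complement n S M a b = torus {2..n} - landau_variety n S M a b"


section \<open>The moduli space of marked genus 0 curves\<close>

text \<open>
  A smooth complex curve of genus 0 is isomorphic to the projective line, whose automorphisms are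
  the Moebius transformations.  So \<open>\<MM>\<^sub>0\<^sub>,\<^sub>m\<close> is the set of \<open>m\<close>-tuples of distinct points of the
  projective line modulo Moebius transformations.
\<close>

datatype proj_line = Aff complex | Infty

fun moebius :: "complex \<Rightarrow> complex \<Rightarrow> complex \<Rightarrow> complex \<Rightarrow> proj_line \<Rightarrow> proj_line" where
  "moebius p q r s (Aff z) =
     (if r * z + s = 0 then Infty else Aff ((p * z + q) / (r * z + s)))"
| "moebius p q r s Infty = (if r = 0 then Infty else Aff (p / r))"

definition configs :: "nat \<Rightarrow> proj_line list set" where
  "configs m = {xs. length xs = m \<and> distinct xs}"

definition config_iso :: "nat \<Rightarrow> (proj_line list \<times> proj_line list) set" where
  "config_iso m = {(xs, ys). xs \<in> configs m \<and> ys \<in> configs m \<and>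
     (\<exists>p q r s. p * s - q * r \<noteq> 0 \<and> ys = map (moebius p q r s) xs)}"

definition M0 :: "nat \<Rightarrow> proj_line list set set" where
  "M0 m = configs m // config_iso m"

text \<open>
  The set \<open>marked_class xs\<close> is an element of \<open>M0 (length xs)\<close> if the points are distinct;
  otherwise it is empty, hence not an element.
\<close>

definition marked_class :: "proj_line list \<Rightarrow> proj_line list set" where
  "marked_class xs = config_iso (length xs) `` {xs}"

definition forget_last :: "proj_line list set \<Rightarrow> proj_line list set" where
  "forget_last c = butlast ` c"

text \<open>
  For \<open>m \<ge> 3\<close> every class in \<open>M0 m\<close> contains exactly one configuration with first three points
  0, \<open>\<infinity>\<close>, 1; the remaining \<open>m - 3\<close> points are the coordinates that identify \<open>\<MM>\<^sub>0\<^sub>,\<^sub>m\<close> with an open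
  subvariety of affine space.  A map to \<open>\<MM>\<^sub>0\<^sub>,\<^sub>m\<close> is a morphism if these coordinates are regular
  functions.  On complements of finitely many hypersurfaces in a torus, which are principal open
  subsets of affine space, regular functions are global fractions.  The integer coefficients make
  the morphism defined over the rationals.
\<close>

definition regular_to_M0 ::
    "nat set \<Rightarrow> (nat \<Rightarrow> complex) set \<Rightarrow> nat \<Rightarrow> ((nat \<Rightarrow> complex) \<Rightarrow> proj_line list set) \<Rightarrow> bool" where
  "regular_to_M0 I U m \<Phi> \<longleftrightarrow>
     (\<exists>P Q :: nat \<Rightarrow> int_mpoly. (\<forall>k < m - 3. P k \<in> int_polys I \<and> Q k \<in> int_polys I) \<and>
       (\<forall>x \<in> U. (\<forall>k < m - 3. peval (Q k) x \<noteq> 0) \<and>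
          [Aff 0, Infty, Aff 1] @ map (\<lambda>k. Aff (peval (P k) x / peval (Q k) x)) [0..<m - 3]
            \<in> \<Phi> x))"


section \<open>The classifying maps\<close>

definition base_points ::
    "nat \<Rightarrow> (nat \<Rightarrow> int_mpoly) \<Rightarrow> (nat \<Rightarrow> int_mpoly) \<Rightarrow> (nat \<Rightarrow> complex) \<Rightarrow> proj_line list" where
  "base_points M a b t =
     [Aff 0, Infty] @ map (\<lambda>i. Aff (- peval (b i) t / peval (a i) t)) [1..<Suc M]"

definition rho_bar ::
    "nat \<Rightarrow> (nat \<Rightarrow> int_mpoly) \<Rightarrow> (nat \<Rightarrow> int_mpoly) \<Rightarrow> (nat \<Rightarrow> complex) \<Rightarrow> proj_line list set" where
  "rho_bar M a b t = marked_class (base_points M a b t)"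

definition rho ::
    "nat \<Rightarrow> nat \<Rightarrow> (nat \<Rightarrow> int_mpoly) \<Rightarrow> (nat \<Rightarrow> int_mpoly) \<Rightarrow> (nat \<Rightarrow> complex) \<Rightarrow> proj_line list set" where
  "rho n M a b x = marked_class (base_points M a b (proj n x) @ [Aff (x 1)])"


section \<open>Well-definedness of the moduli space and of the forgetful map\<close>

lemma moebius_id: "moebius 1 0 0 1 = id"
proof
  fix x show "moebius 1 0 0 1 x = id x" by (cases x) auto
qed

lemma moebius_compose:
  assumes d: "p * s - q * r \<noteq> 0" and d': "p' * s' - q' * r' \<noteq> 0"
  shows "moebius p' q' r' s' (moebius p q r s x)
    = moebius (p' * p + q' * r) (p' * q + q' * s) (r' * p + s' * r) (r' * q + s' * s) x"
proof (cases x)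
  case (Aff z)
  show ?thesis
  proof (cases "r * z + s = 0")
    case True
    then have s: "s = - (r * z)" by algebra
    have "p * z + q \<noteq> 0"
    proof
      assume "p * z + q = 0"
      then have "q = - (p * z)" by algebra
      with s d show False by simp
    qed
    moreover have "(p' * p + q' * r) * z + (p' * q + q' * s) = p' * (p * z + q)"
      and "(r' * p + s' * r) * z + (r' * q + s' * s) = r' * (p * z + q)"
      unfolding s by algebra+
    ultimately show ?thesis using Aff True by simp
  next
    case False
    have "r' * ((p * z + q) / (r * z + s)) + s'
        = ((r' * p + s' * r) * z + (r' * q + s' * s)) / (r * z + s)"
      and "p' * ((p * z + q) / (r * z + s)) + q'
        = ((p' * p + q' * r) * z + (p' * q + q' * s)) / (r * z + s)"
      using False by (simp_all add: field_simps)
    then show ?thesis using Aff False by simp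
  qed
next
  case Infty
  show ?thesis
  proof (cases "r = 0")
    case True
    then have "p \<noteq> 0" using d by auto
    then show ?thesis using Infty True by simp
  next
    case False
    have "r' * (p / r) + s' = (r' * p + s' * r) / r"
      and "p' * (p / r) + q' = (p' * p + q' * r) / r"
      using False by (simp_all add: field_simps)
    then show ?thesis using Infty False by simp
  qed
qed

lemma moebius_scalar: "d \<noteq> 0 \<Longrightarrow> moebius d 0 0 d x = x"
  by (cases x) auto

lemma moebius_inverse:
  assumes "p * s - q * r \<noteq> 0"
  shows "moebius s (- q) (- r) p (moebius p q r s x) = x"
proof -
  have "s * p - (- q) * (- r) \<noteq> 0" using assms by (simp add: algebra_simps)
  from moebius_compose[OF assms this, of x] moebius_scalar[OF assms, of x] show ?thesis
    by (simp add: algebra_simps)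
qed

lemma inj_moebius: "p * s - q * r \<noteq> 0 \<Longrightarrow> inj (moebius p q r s)"
  by (metis injI moebius_inverse)

lemma map_moebius_configs:
  "p * s - q * r \<noteq> 0 \<Longrightarrow> xs \<in> configs m \<Longrightarrow> map (moebius p q r s) xs \<in> configs m"
  using inj_moebius[of p s q r] by (auto simp: configs_def distinct_map intro: inj_on_subset)

lemma equiv_config_iso: "equiv (configs m) (config_iso m)"
proof (rule equivI)
  show "config_iso m \<subseteq> configs m \<times> configs m" by (auto simp: config_iso_def)
  show "refl_on (configs m) (config_iso m)"
  proof (rule refl_onI)
    fix xs assume "xs \<in> configs m"
    moreover have "1 * 1 - 0 * 0 \<noteq> (0::complex)" "xs = map (moebius 1 0 0 1) xs"
      by (simp_all add: moebius_id)
    ultimately show "(xs, xs) \<in> config_iso m" unfolding config_iso_def by blast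
  qed
  show "sym (config_iso m)"
  proof (rule symI)
    fix xs ys assume "(xs, ys) \<in> config_iso m"
    then obtain p q r s where *: "xs \<in> configs m" "ys \<in> configs m" "p * s - q * r \<noteq> 0"
      "ys = map (moebius p q r s) xs" by (auto simp: config_iso_def)
    have "xs = map (moebius s (- q) (- r) p) ys"
      using moebius_inverse[OF *(3)] by (simp add: *(4) o_def)
    moreover have "s * p - (- q) * (- r) \<noteq> 0" using *(3) by (simp add: algebra_simps)
    ultimately show "(ys, xs) \<in> config_iso m" using *(1,2) unfolding config_iso_def by blast
  qed
  show "trans (config_iso m)"
  proof (rule transI)
    fix xs ys zs assume "(xs, ys) \<in> config_iso m" "(ys, zs) \<in> config_iso m"
    then obtain p q r s p' q' r' s' where *: "xs \<in> configs m" "zs \<in> configs m"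
      "p * s - q * r \<noteq> 0" "ys = map (moebius p q r s) xs"
      "p' * s' - q' * r' \<noteq> 0" "zs = map (moebius p' q' r' s') ys"
      by (auto simp: config_iso_def)
    have "zs = map (moebius (p' * p + q' * r) (p' * q + q' * s)
        (r' * p + s' * r) (r' * q + s' * s)) xs"
      by (simp add: *(4,6) moebius_compose[OF *(3,5)])
    moreover have "(p' * p + q' * r) * (r' * q + s' * s) - (p' * q + q' * s) * (r' * p + s' * r)
        = (p * s - q * r) * (p' * s' - q' * r')"
      by algebra
    then have "(p' * p + q' * r) * (r' * q + s' * s) - (p' * q + q' * s) * (r' * p + s' * r) \<noteq> 0"
      using *(3,5) by simp
    ultimately show "(xs, zs) \<in> config_iso m" using *(1,2) unfolding config_iso_def by blast
  qed
qed

lemma marked_class_eq: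
  "xs \<in> configs m \<Longrightarrow>
    marked_class xs = {map (moebius p q r s) xs | p q r s. p * s - q * r \<noteq> 0}"
  using map_moebius_configs[of _ _ _ _ xs m]
  by (auto simp: marked_class_def config_iso_def configs_def)

lemma forget_last_marked_class:
  assumes "xs \<in> configs m"
  shows "forget_last (marked_class xs) = marked_class (butlast xs)"
proof -
  have "butlast xs \<in> configs (m - 1)" using assms by (auto simp: configs_def distinct_butlast)
  with assms show ?thesis
    by (auto simp: marked_class_eq forget_last_def image_def map_butlast) (metis map_butlast)
qed

end

theory Submission
  imports Defs
begin

text \<open>
  Off \<open>L(S,\<pi>)\<close> the numbers \<open>a\<^sub>i\<close>, \<open>b\<^sub>i\<close> and \<open>a\<^sub>i b\<^sub>j - a\<^sub>j b\<^sub>i\<close> do not vanish, so the points \<open>0, \<infinity>\<close> and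
  \<open>-b\<^sub>i/a\<^sub>i\<close> are distinct; off \<open>S\<close> the point \<open>\<alpha>\<^sub>1\<close> is none of them.  Dividing by \<open>-b\<^sub>1/a\<^sub>1\<close> fixes
  \<open>0, \<infinity>\<close>, moves the third point to \<open>1\<close>, and gives the moduli coordinates
  \<open>b\<^sub>i a\<^sub>1/(a\<^sub>i b\<^sub>1)\<close> and \<open>-\<alpha>\<^sub>1 a\<^sub>1/b\<^sub>1\<close>.
\<close>

section \<open>Additivity and multiplicativity of evaluation\<close>

definition monom_eval :: "(nat \<Rightarrow>\<^sub>0 nat) \<Rightarrow> (nat \<Rightarrow> complex) \<Rightarrow> complex" where
  "monom_eval m x = (\<Prod>i \<in> Poly_Mapping.keys m. x i ^ Poly_Mapping.lookup m i)"

text \<open>The additional factors are \<open>x i ^ 0 = 1\<close>. A common index set makes the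
  products for \<open>k\<close>, \<open>l\<close> and \<open>k + l\<close> comparable, although
  their key sets may differ.\<close>

lemma monom_eval_superset:
  assumes "finite A" "Poly_Mapping.keys m \<subseteq> A"
  shows "monom_eval m x = (\<Prod>i \<in> A. x i ^ Poly_Mapping.lookup m i)"
  unfolding monom_eval_def
  by (rule prod.mono_neutral_left) (use assms in \<open>auto simp: in_keys_iff\<close>)

lemma monom_eval_add: "monom_eval (k + l) x = monom_eval k x * monom_eval l x"
proof -
  let ?A = "Poly_Mapping.keys k \<union> Poly_Mapping.keys l"
  have "monom_eval m x = (\<Prod>i \<in> ?A. x i ^ Poly_Mapping.lookup m i)" if "m \<in> {k, l, k + l}" for m
    using that keys_add[of k l] by (intro monom_eval_superset) auto
  then show ?thesis by (simp add: lookup_add power_add prod.distrib)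
qed

lemma peval_add: "peval (p + q) x = peval p x + peval q x"
  unfolding peval_def
  \<comment> \<open>Keys lost by cancellation in \<open>p + q\<close> have total coefficient 0, and
    a summand with coefficient 0 vanishes, so all sums may run over the union of the keys.\<close>
  by (rule setsum_keys_plus_distrib) (simp_all add: algebra_simps)

lemma peval_uminus: "peval (- p) x = - peval p x"
  by (simp add: peval_def sum_negf)

lemma peval_diff: "peval (p - q) x = peval p x - peval q x"
  using peval_add[of p "- q" x] by (simp add: peval_uminus)

lemma peval_single_one: "peval (Poly_Mapping.single m 1) x = monom_eval m x"
  by (simp add: peval_def monom_eval_def)

text \<open>Integer polynomials form the free abelian group on the monomials, and both sides are
  additive in each factor. So it suffices to treat 0, monomials with coefficient 1, and
  differences.\<close>

lemma peval_mult: "peval (p * q) x = peval p x * peval q x"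
proof (induction p rule: frag_induction[OF subset_UNIV])
  case 1
  show ?case by (simp add: peval_def)
next
  case (2 k)
  show ?case
  proof (induction q rule: frag_induction[OF subset_UNIV])
    case 1
    show ?case by (simp add: peval_def)
  next
    case (2 l)
    show ?case by (simp add: mult_single peval_single_one monom_eval_add)
  next
    case (3 p q)
    then show ?case by (simp add: peval_diff right_diff_distrib)
  qed
next
  case (3 p p')
  then show ?case by (simp add: peval_diff left_diff_distrib)
qed

lemma peval_Var: "peval (Var i) x = x i"
  by (simp add: Var_def peval_single_one monom_eval_def)

section \<open>Polynomials in a given set of variables\<close>

lemma peval_restrict:
  assumes "p \<in> int_polys I"
  shows "peval p (restrict x I) = peval p x"
  using assms unfolding peval_def int_polys_def
  by (intro sum.cong prod.cong arg_cong2[where f = "(*)"]) (auto simp: subset_iff)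

lemma int_polys_mono: "I \<subseteq> J \<Longrightarrow> p \<in> int_polys I \<Longrightarrow> p \<in> int_polys J"
  by (auto simp: int_polys_def)

lemma int_polys_uminus: "p \<in> int_polys I \<Longrightarrow> - p \<in> int_polys I"
  by (simp add: int_polys_def)

lemma int_polys_mult:
  assumes "p \<in> int_polys I" "q \<in> int_polys I"
  shows "p * q \<in> int_polys I"
  unfolding int_polys_def
proof (intro CollectI ballI)
  fix m assume "m \<in> Poly_Mapping.keys (p * q)"
  then obtain k l where "m = k + l" "k \<in> Poly_Mapping.keys p" "l \<in> Poly_Mapping.keys q"
    using keys_mult[of p q] by auto
  then have "Poly_Mapping.keys k \<union> Poly_Mapping.keys l \<subseteq> I"
    using assms by (simp add: int_polys_def)
  then show "Poly_Mapping.keys m \<subseteq> I"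
    using keys_add[of k l] \<open>m = k + l\<close> by blast
qed

lemma int_polys_Var: "i \<in> I \<Longrightarrow> Var i \<in> int_polys I"
  by (simp add: int_polys_def Var_def)

section \<open>Classes of configurations and forgetting a point\<close>

lemma marked_class_in_M0: "xs \<in> configs m \<Longrightarrow> marked_class xs \<in> M0 m"
  by (auto simp: marked_class_def M0_def configs_def intro: quotientI)

lemma M0_E:
  assumes "c \<in> M0 m"
  obtains xs where "xs \<in> configs m" "c = marked_class xs"
  using assms by (auto simp: M0_def marked_class_def configs_def elim!: quotientE)

lemma butlast_configs: "xs \<in> configs (Suc m) \<Longrightarrow> butlast xs \<in> configs m"
  by (auto simp: configs_def distinct_butlast)

lemma forget_last_M0: "c \<in> M0 (Suc m) \<Longrightarrow> forget_last c \<in> M0 m"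
  by (auto elim!: M0_E simp: forget_last_marked_class intro!: marked_class_in_M0 butlast_configs)

section \<open>Distinctness and normal form of the marked points\<close>

lemma scaled_in_marked_class:
  assumes "xs \<in> configs m" "c \<noteq> 0"
  shows "map (moebius c 0 0 1) xs \<in> marked_class xs"
  using assms by (force simp: marked_class_eq)

lemma base_points_in_configs:
  assumes nz: "\<forall>i \<in> {1..M}. peval (a i) t \<noteq> 0 \<and> peval (b i) t \<noteq> 0"
    and cross: "\<And>i j. 1 \<le> i \<Longrightarrow> i < j \<Longrightarrow> j \<le> M \<Longrightarrow>
      peval (a i) t * peval (b j) t - peval (a j) t * peval (b i) t \<noteq> 0"
  shows "base_points M a b t \<in> configs (M + 2)"
proof -
  define z where "z i = - peval (b i) t / peval (a i) t" for i
  have points: "base_points M a b t = [Aff 0, Infty] @ map (\<lambda>i. Aff (z i)) [1..<Suc M]"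
    by (simp add: base_points_def z_def)
  \<comment> \<open>Clearing denominators in \<open>z i = z j\<close> would make the cross
    difference vanish.\<close>
  have "z i \<noteq> z j" if "1 \<le> i" "i < j" "j \<le> M" for i j
    using bspec[OF nz, of i] bspec[OF nz, of j] cross[OF that] that
    by (auto simp: z_def field_simps)
  then have "inj_on z {1..<Suc M}"
    by (intro linorder_inj_onI') auto
  then have "inj_on (\<lambda>i. Aff (z i)) {1..<Suc M}"
    unfolding inj_on_def by blast
  then have "distinct (map (\<lambda>i. Aff (z i)) [1..<Suc M])"
    by (simp only: distinct_map distinct_upt set_upt)
  moreover have "\<forall>i \<in> {1..<Suc M}. z i \<noteq> 0"
    using nz by (simp add: z_def)
  ultimately show ?thesis
    by (auto simp: configs_def points simp del: upt_Suc)
qed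

text \<open>Splits off the index 1, whose point gets normalized to 1, and numbers the others from 0
  as \<open>regular_to_M0\<close> does.\<close>

lemma upt_Suc_0_conv: "M \<ge> 1 \<Longrightarrow> [Suc 0..<Suc M] = Suc 0 # map (\<lambda>k. k + 2) [0..<M - 1]"
  by (rule nth_equalityI) (auto simp: nth_Cons' simp del: upt_Suc)

text \<open>The scaling factor is the reciprocal of the first root. The products stand inside
  \<open>peval\<close> because \<open>regular_to_M0\<close> asks for polynomial numerators and
  denominators.\<close>

lemma scaled_base_points:
  assumes "M \<ge> 1"
    and nz: "\<forall>i \<in> {1..M}. peval (a i) t \<noteq> 0 \<and> peval (b i) t \<noteq> 0"
  shows "map (moebius (- peval (a 1) t / peval (b 1) t) 0 0 1) (base_points M a b t) =
    [Aff 0, Infty, Aff 1] @ map (\<lambda>k. Aff (peval (b (k + 2) * a 1) t / peval (a (k + 2) * b 1) t))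
      [0..<M - 1]"
  using bspec[OF nz, of 1] assms(1)
  by (simp add: base_points_def upt_Suc_0_conv peval_mult mult.commute del: upt_Suc)

theorem lemma100:
  fixes n M :: nat
    and S :: "int_mpoly set"
    and h a b :: "nat \<Rightarrow> int_mpoly"
  assumes "n \<ge> 1"
    and "finite S"
    and "\<forall>p \<in> S. irreducible_hypersurface n p"
    and "inj_on (zero_locus {1..n}) S"
    and "\<forall>p \<in> horizontal S. degree_in 1 p = 1"
    and "M \<ge> 1"
    and "bij_betw h {1..M} (horizontal S)"
    and "\<forall>i \<in> {1..M}. a i \<in> int_polys {2..n} \<and> b i \<in> int_polys {2..n} \<and>
           h i = a i * Var 1 + b i \<and> a i * b i \<noteq> 0"
  shows "proj n \<in> total_complement n S M a b \<rightarrow> base_complement n S M a b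
    \<and> rho n M a b \<in> total_complement n S M a b \<rightarrow> M0 (M + 3)
    \<and> rho_bar M a b \<in> base_complement n S M a b \<rightarrow> M0 (M + 2)
    \<and> forget_last \<in> M0 (M + 3) \<rightarrow> M0 (M + 2)
    \<and> regular_to_M0 {1..n} (total_complement n S M a b) (M + 3) (rho n M a b)
    \<and> regular_to_M0 {2..n} (base_complement n S M a b) (M + 2) (rho_bar M a b)
    \<and> (\<forall>x \<in> total_complement n S M a b.
          forget_last (rho n M a b x) = rho_bar M a b (proj n x))"
proof -
  let ?B = "base_complement n S M a b" and ?T = "total_complement n S M a b"
  have a: "a i \<in> int_polys {2..n}" and b: "b i \<in> int_polys {2..n}"
    and h: "h i = a i * Var 1 + b i" and hS: "h i \<in> S" if "i \<in> {1..M}" for i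
    using assms(7,8) that by (auto simp: bij_betw_def horizontal_def)
  note mono = int_polys_mono[of "{2..n}" "{1..n}"]

  have nz: "\<forall>i \<in> {1..M}. peval (a i) t \<noteq> 0 \<and> peval (b i) t \<noteq> 0" if "t \<in> ?B" for t
    using that by (auto simp: base_complement_def landau_variety_def zero_locus_def)
  have base_conf: "base_points M a b t \<in> configs (M + 2)" if t: "t \<in> ?B" for t
  proof (rule base_points_in_configs)
    fix i j assume ij: "1 \<le> i" "i < j" "j \<le> M"
    have "t \<notin> zero_locus {2..n} (a i * b j - a j * b i)"
      using t ij unfolding base_complement_def landau_variety_def by fastforce
    moreover have "t \<in> torus {2..n}" using t by (simp add: base_complement_def)
    ultimately show "peval (a i) t * peval (b j) t - peval (a j) t * peval (b i) t \<noteq> 0"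
      by (simp add: zero_locus_def peval_diff peval_mult)
  qed (rule nz[OF t])

  have proj: "proj n x \<in> ?B" if "x \<in> ?T" for x
    using that by (auto simp: total_complement_def base_complement_def torus_def proj_def)
  \<comment> \<open>The variable 1 does not occur in \<open>a i\<close> and \<open>b i\<close>, so
    forgetting that coordinate leaves their values unchanged.\<close>
  have peval_proj: "peval (a i) (proj n x) = peval (a i) x" "peval (b i) (proj n x) = peval (b i) x"
    if "i \<in> {1..M}" for i x
    using a[OF that] b[OF that] by (simp_all add: proj_def peval_restrict)
  have nzT: "peval (a i) x \<noteq> 0 \<and> peval (b i) x \<noteq> 0" if "x \<in> ?T" "i \<in> {1..M}" for x i
    using bspec[OF nz[OF proj[OF that(1)]] that(2)] that(2) by (simp add: peval_proj)
  have x1: "x 1 \<noteq> 0" if "x \<in> ?T" for x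
    using that \<open>n \<ge> 1\<close> by (auto simp: total_complement_def torus_def)

  have total_conf: "base_points M a b (proj n x) @ [Aff (x 1)] \<in> configs (M + 3)" if x: "x \<in> ?T" for x
  proof -
    define z where "z i = - peval (b i) (proj n x) / peval (a i) (proj n x)" for i
    have z: "base_points M a b (proj n x) = [Aff 0, Infty] @ map (\<lambda>i. Aff (z i)) [1..<Suc M]"
      by (simp add: base_points_def z_def)
    have "x 1 \<noteq> z i" if i: "i \<in> {1..M}" for i
    proof
      assume "x 1 = z i"
      \<comment> \<open>The value of \<open>h i\<close> at \<open>x\<close> is that of
        \<open>a i\<close> times \<open>x 1 - z i\<close>, so a collision would put \<open>x\<close>
        on a component of \<open>S\<close>.\<close>
      then have "peval (h i) x = 0"
        using nzT[OF x i] i by (simp add: h peval_add peval_mult peval_Var peval_proj z_def)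
      then show False
        using x hS[OF i] by (auto simp: total_complement_def zero_locus_def)
    qed
    then have "x 1 \<notin> z ` {1..<Suc M}"
      by (metis imageE atLeastLessThanSuc_atLeastAtMost)
    then have "Aff (x 1) \<notin> set (base_points M a b (proj n x))"
      using x1[OF x] by (simp add: z image_iff del: upt_Suc)
    then show ?thesis
      using base_conf[OF proj[OF x]] by (simp add: configs_def)
  qed

  have rho_bar_regular: "regular_to_M0 {2..n} ?B (M + 2) (rho_bar M a b)"
    unfolding regular_to_M0_def
  proof (intro exI conjI allI impI ballI)
    fix k assume "k < M + 2 - 3"
    \<comment> \<open>Since \<open>M + 2 - 3 = M - 1\<close>, the index \<open>k + 2\<close> runs
      from 2 to \<open>M\<close>; root 1 is used up by the normalization.\<close>
    then have k: "k + 2 \<in> {1..M}" "1 \<in> {1..M}" by auto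
    show "b (k + 2) * a 1 \<in> int_polys {2..n}" "a (k + 2) * b 1 \<in> int_polys {2..n}"
      using a b k by (auto intro!: int_polys_mult)
    show "peval (a (k + 2) * b 1) t \<noteq> 0" if "t \<in> ?B" for t
      using nz[OF that] k by (simp add: peval_mult)
  next
    fix t assume t: "t \<in> ?B"
    let ?c = "- peval (a 1) t / peval (b 1) t"
    have "?c \<noteq> 0" using nz[OF t] \<open>M \<ge> 1\<close> by simp
    from scaled_in_marked_class[OF base_conf[OF t] this]
    show "[Aff 0, Infty, Aff 1] @
      map (\<lambda>k. Aff (peval (b (k + 2) * a 1) t / peval (a (k + 2) * b 1) t)) [0..<M + 2 - 3]
      \<in> rho_bar M a b t"
      unfolding scaled_base_points[OF \<open>M \<ge> 1\<close> nz[OF t]]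
      by (simp add: rho_bar_def)
  qed

  \<comment> \<open>The last coordinate, at index \<open>M - 1\<close>, is the rescaled fiber point
    \<open>x 1\<close>; the earlier ones are the coordinates of the base.\<close>
  define P where "P k = (if k = M - 1 then - (Var 1 * a 1) else b (k + 2) * a 1)" for k
  define Q where "Q k = (if k = M - 1 then b 1 else a (k + 2) * b 1)" for k
  have rho_regular: "regular_to_M0 {1..n} ?T (M + 3) (rho n M a b)"
    unfolding regular_to_M0_def
  proof (intro exI conjI allI impI ballI)
    fix k assume "k < M + 3 - 3"
    then have k: "k \<noteq> M - 1 \<Longrightarrow> k + 2 \<in> {1..M}" "1 \<in> {1..M}" by auto
    show "P k \<in> int_polys {1..n}" "Q k \<in> int_polys {1..n}"
      using a b k mono \<open>n \<ge> 1\<close>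
      by (auto simp: P_def Q_def intro!: int_polys_mult int_polys_uminus int_polys_Var)
    show "peval (Q k) x \<noteq> 0" if "x \<in> ?T" for x
      using nzT[OF that k(1)] nzT[OF that k(2)] by (simp add: Q_def peval_mult)
  next
    fix x assume x: "x \<in> ?T"
    let ?t = "proj n x"
    let ?c = "- peval (a 1) ?t / peval (b 1) ?t"
    let ?f = "\<lambda>k. Aff (peval (P k) x / peval (Q k) x)"
    have 1: "1 \<in> {1..M}" using \<open>M \<ge> 1\<close> by simp
    have "?c \<noteq> 0" using nz[OF proj[OF x]] 1 by simp
    from scaled_in_marked_class[OF total_conf[OF x] this]
    have "map (moebius ?c 0 0 1) (base_points M a b ?t) @ [Aff (?c * x 1)] \<in> rho n M a b x"
      by (simp add: rho_def)
    moreover have "map (moebius ?c 0 0 1) (base_points M a b ?t) =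
        [Aff 0, Infty, Aff 1] @ map ?f [0..<M - 1]"
      unfolding scaled_base_points[OF \<open>M \<ge> 1\<close> nz[OF proj[OF x]]]
      using 1 by (auto simp: P_def Q_def peval_mult peval_proj)
    moreover have "Aff (?c * x 1) = ?f (M - 1)"
      using 1 by (simp add: P_def Q_def peval_mult peval_uminus peval_Var peval_proj)
    \<comment> \<open>Here \<open>M \<ge> 1\<close> matters: for \<open>M = 0\<close> truncated
      subtraction would give \<open>[0]\<close> on the right and the empty list on the left.\<close>
    moreover have "[0..<M + 3 - 3] = [0..<M - 1] @ [M - 1]"
      using \<open>M \<ge> 1\<close> by (cases M) auto
    ultimately show "[Aff 0, Infty, Aff 1] @ map ?f [0..<M + 3 - 3] \<in> rho n M a b x"
      by simp
  qed

  \<comment> \<open>The dropped point is the appended \<open>x 1\<close>; what remains is the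
    configuration that defines \<open>rho_bar\<close>.\<close>
  have "forget_last (rho n M a b x) = rho_bar M a b (proj n x)" if "x \<in> ?T" for x
    using forget_last_marked_class[OF total_conf[OF that]] by (simp add: rho_def rho_bar_def)
  moreover have "forget_last \<in> M0 (M + 3) \<rightarrow> M0 (M + 2)"
    using forget_last_M0[of _ "M + 2"] by (simp add: numeral_eq_Suc)
  moreover have "rho n M a b \<in> ?T \<rightarrow> M0 (M + 3)"
    using total_conf by (simp add: rho_def marked_class_in_M0)
  moreover have "rho_bar M a b \<in> ?B \<rightarrow> M0 (M + 2)"
    using base_conf by (simp add: rho_bar_def marked_class_in_M0)
  ultimately show ?thesis
    using proj rho_regular rho_bar_regular by blast
qed

end
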